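(* Let $Q_n(\mathbf a,\mathbf b,\mathbf c,\mathbf d,\mathbf e)$ be the polynomial in the indeterminates $a_{\ell,\ell'},b_{\ell,\ell'},c_{\ell,\ell'},d_{\ell,\ell'},e_\ell$ ($\ell,\ell'\ge0$) defined in the context by means of cyclic statistics. Then $$Q_n(\mathbf a,\mathbf b,\mathbf c,\mathbf d,\mathbf e)=\sum_{\sigma\in\mathfrak S_n}\ \prod_{i\in\mathrm{Val}(\sigma)}a_{(2\text{-}31)(i,\sigma),\,(31\text{-}2)(i,\sigma)}\prod_{i\in\mathrm{Peak}(\sigma)}b_{(2\text{-}31)(i,\sigma),\,(31\text{-}2)(i,\sigma)}$$ $$\times\prod_{i\in\mathrm{Dasc}(\sigma)\setminus\mathrm{Arda}(\sigma)}c_{(2\text{-}31)(i,\sigma)-1,\,(31\text{-}2)(i,\sigma)}\prod_{i\in\mathrm{Ddes}(\sigma)}d_{(2\text{-}31)(i,\sigma),\,(31\text{-}2)(i,\sigma)}\prod_{i\in\mathrm{Arda}(\sigma)}e_{(31\text{-}2)(i,\sigma)}.$$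
   Context: $\mathfrak S_n$ is the set of permutations of $[n]=\{1,\dots,n\}$. Cyclic side. For $\sigma\in\mathfrak S_n$, $\mathrm{Cpeak}$, $\mathrm{Cval}$, $\mathrm{Cdrise}$, $\mathrm{Cdfall}$, $\mathrm{Fix}$ are the sets of $i\in[n]$ with, respectively, $\sigma^{-1}(i)<i>\sigma(i)$; $\sigma^{-1}(i)>i<\sigma(i)$; $\sigma^{-1}(i)<i<\sigma(i)$; $\sigma^{-1}(i)>i>\sigma(i)$; $\sigma(i)=i$. Put $\mathrm{ucross}(j,\sigma)=\#\{i<j<k<l: k=\sigma(i),\ l=\sigma(j)\}$, $\mathrm{unest}(j,\sigma)=\#\{i<j<k<l: k=\sigma(j),\ l=\sigma(i)\}$, $\mathrm{lcross}(k,\sigma)=\#\{i<j<k<l: i=\sigma(k),\ j=\sigma(l)\}$, $\mathrm{lnest}(k,\sigma)=\#\{i<j<k<l: i=\sigma(l),\ j=\sigma(k)\}$, and for a fixed point $j$, $\mathrm{lev}(j,\sigma)=\#\{i<j<l: l=\sigma(i)\}$. Then $$Q_n(\mathbf a,\mathbf b,\mathbf c,\mathbf d,\mathbf e)=\sum_{\sigma\in\mathfrak S_n}\prod_{i\in\mathrm{Cval}}a_{\mathrm{ucross}(i,\sigma),\mathrm{unest}(i,\sigma)}\prod_{i\in\mathrm{Cpeak}}b_{\mathrm{lcross}(i,\sigma),\mathrm{lnest}(i,\sigma)}\prod_{i\in\mathrm{Cdfall}}c_{\mathrm{lcross}(i,\sigma),\mathrm{lnest}(i,\sigma)}\prod_{i\in\mathrm{Cdrise}}d_{\mathrm{ucross}(i,\sigma),\mathrm{unest}(i,\sigma)}\prod_{i\in\mathrm{Fix}}e_{\mathrm{lev}(i,\sigma)}.$$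 Linear side. With the convention $\sigma(0)=0$, $\sigma(n+1)=n+1$, a value $\sigma(i)$ ($1\le i\le n$) is a double ascent if $\sigma(i-1)<\sigma(i)<\sigma(i+1)$, a double descent if $\sigma(i-1)>\sigma(i)>\sigma(i+1)$, a peak if $\sigma(i-1)<\sigma(i)>\sigma(i+1)$, a valley if $\sigma(i-1)>\sigma(i)<\sigma(i+1)$. A value $\sigma(i)$ is an antirecord if $\sigma(j)>\sigma(i)$ for all $i<j\le n$, and an antirecord double ascent if it is both an antirecord and a double ascent. $\mathrm{Dasc},\mathrm{Ddes},\mathrm{Peak},\mathrm{Val},\mathrm{Arda}$ denote the sets of values that are double ascents, double descents, peaks, valleys, antirecord double ascents, respectively. For a value $i\in[n]$, $(31\text{-}2)(i,\sigma)=\#\{j: 1<j<\sigma^{-1}(i),\ \sigma(j)<i<\sigma(j-1)\}$, $(2\text{-}31)(i,\sigma)=\#\{j: \sigma^{-1}(i)<j<n,\ \sigma(j+1)<i<\sigma(j)\}$. *)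

theory Defs
  imports
    Complex_Main
    "HOL-Combinatorics.Permutations"
    "HOL-Library.Poly_Mapping"
begin

text \<open>
  A permutation of \<open>[n]\<close> is a function \<open>\<sigma>\<close> with \<open>\<sigma> permutes {1..n}\<close>. It is the identity
  outside \<open>{1..n}\<close>, so the boundary convention of the linear statistics,
  \<open>\<sigma> 0 = 0\<close> and \<open>\<sigma> (n + 1) = n + 1\<close>, holds for it automatically.
\<close>

subsection \<open>Cyclic statistics\<close>

definition Cpeak :: "nat \<Rightarrow> (nat \<Rightarrow> nat) \<Rightarrow> nat set" where
  "Cpeak n \<sigma> = {i \<in> {1..n}. inv \<sigma> i < i \<and> i > \<sigma> i}"

definition Cval :: "nat \<Rightarrow> (nat \<Rightarrow> nat) \<Rightarrow> nat set" where
  "Cval n \<sigma> = {i \<in> {1..n}. inv \<sigma> i > i \<and> i < \<sigma> i}"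

definition Cdrise :: "nat \<Rightarrow> (nat \<Rightarrow> nat) \<Rightarrow> nat set" where
  "Cdrise n \<sigma> = {i \<in> {1..n}. inv \<sigma> i < i \<and> i < \<sigma> i}"

definition Cdfall :: "nat \<Rightarrow> (nat \<Rightarrow> nat) \<Rightarrow> nat set" where
  "Cdfall n \<sigma> = {i \<in> {1..n}. inv \<sigma> i > i \<and> i > \<sigma> i}"

definition Fix :: "nat \<Rightarrow> (nat \<Rightarrow> nat) \<Rightarrow> nat set" where
  "Fix n \<sigma> = {i \<in> {1..n}. \<sigma> i = i}"

definition ucross :: "nat \<Rightarrow> nat \<Rightarrow> (nat \<Rightarrow> nat) \<Rightarrow> nat" where
  "ucross n j \<sigma> = card {(i, k, l). {i, k, l} \<subseteq> {1..n} \<and>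
     i < j \<and> j < k \<and> k < l \<and> k = \<sigma> i \<and> l = \<sigma> j}"

definition unest :: "nat \<Rightarrow> nat \<Rightarrow> (nat \<Rightarrow> nat) \<Rightarrow> nat" where
  "unest n j \<sigma> = card {(i, k, l). {i, k, l} \<subseteq> {1..n} \<and>
     i < j \<and> j < k \<and> k < l \<and> k = \<sigma> j \<and> l = \<sigma> i}"

definition lcross :: "nat \<Rightarrow> nat \<Rightarrow> (nat \<Rightarrow> nat) \<Rightarrow> nat" where
  "lcross n k \<sigma> = card {(i, j, l). {i, j, l} \<subseteq> {1..n} \<and>
     i < j \<and> j < k \<and> k < l \<and> i = \<sigma> k \<and> j = \<sigma> l}"

definition lnest :: "nat \<Rightarrow> nat \<Rightarrow> (nat \<Rightarrow> nat) \<Rightarrow> nat" where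
  "lnest n k \<sigma> = card {(i, j, l). {i, j, l} \<subseteq> {1..n} \<and>
     i < j \<and> j < k \<and> k < l \<and> i = \<sigma> l \<and> j = \<sigma> k}"

definition lev :: "nat \<Rightarrow> nat \<Rightarrow> (nat \<Rightarrow> nat) \<Rightarrow> nat" where
  "lev n j \<sigma> = card {(i, l). {i, l} \<subseteq> {1..n} \<and> i < j \<and> j < l \<and> l = \<sigma> i}"

definition Q :: "nat \<Rightarrow> (nat \<Rightarrow> nat \<Rightarrow> 'r) \<Rightarrow> (nat \<Rightarrow> nat \<Rightarrow> 'r) \<Rightarrow> (nat \<Rightarrow> nat \<Rightarrow> 'r) \<Rightarrow>
    (nat \<Rightarrow> nat \<Rightarrow> 'r) \<Rightarrow> (nat \<Rightarrow> 'r) \<Rightarrow> 'r::comm_ring_1" where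
  "Q n a b c d e = (\<Sum>\<sigma> | \<sigma> permutes {1..n}.
     (\<Prod>i\<in>Cval n \<sigma>. a (ucross n i \<sigma>) (unest n i \<sigma>)) *
     (\<Prod>i\<in>Cpeak n \<sigma>. b (lcross n i \<sigma>) (lnest n i \<sigma>)) *
     (\<Prod>i\<in>Cdfall n \<sigma>. c (lcross n i \<sigma>) (lnest n i \<sigma>)) *
     (\<Prod>i\<in>Cdrise n \<sigma>. d (ucross n i \<sigma>) (unest n i \<sigma>)) *
     (\<Prod>i\<in>Fix n \<sigma>. e (lev n i \<sigma>)))"

subsection \<open>Linear statistics\<close>

text \<open>All of the following are sets of \<^emph>\<open>values\<close> \<open>\<sigma> i\<close>, not of positions \<open>i\<close>.\<close>

definition Dasc :: "nat \<Rightarrow> (nat \<Rightarrow> nat) \<Rightarrow> nat set" where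
  "Dasc n \<sigma> = {\<sigma> i | i. i \<in> {1..n} \<and> \<sigma> (i - 1) < \<sigma> i \<and> \<sigma> i < \<sigma> (i + 1)}"

definition Ddes :: "nat \<Rightarrow> (nat \<Rightarrow> nat) \<Rightarrow> nat set" where
  "Ddes n \<sigma> = {\<sigma> i | i. i \<in> {1..n} \<and> \<sigma> (i - 1) > \<sigma> i \<and> \<sigma> i > \<sigma> (i + 1)}"

definition Peak :: "nat \<Rightarrow> (nat \<Rightarrow> nat) \<Rightarrow> nat set" where
  "Peak n \<sigma> = {\<sigma> i | i. i \<in> {1..n} \<and> \<sigma> (i - 1) < \<sigma> i \<and> \<sigma> i > \<sigma> (i + 1)}"

definition Val :: "nat \<Rightarrow> (nat \<Rightarrow> nat) \<Rightarrow> nat set" where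
  "Val n \<sigma> = {\<sigma> i | i. i \<in> {1..n} \<and> \<sigma> (i - 1) > \<sigma> i \<and> \<sigma> i < \<sigma> (i + 1)}"

definition Antirecord :: "nat \<Rightarrow> (nat \<Rightarrow> nat) \<Rightarrow> nat set" where
  "Antirecord n \<sigma> = {\<sigma> i | i. i \<in> {1..n} \<and> (\<forall>j. i < j \<and> j \<le> n \<longrightarrow> \<sigma> j > \<sigma> i)}"

definition Arda :: "nat \<Rightarrow> (nat \<Rightarrow> nat) \<Rightarrow> nat set" where
  "Arda n \<sigma> = Antirecord n \<sigma> \<inter> Dasc n \<sigma>"

text \<open>The vincular patterns 31-2 and 2-31, with the value \<open>i\<close> playing the role of the 2.\<close>

definition pat_31_2 :: "nat \<Rightarrow> (nat \<Rightarrow> nat) \<Rightarrow> nat" where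
  "pat_31_2 i \<sigma> = card {j. 1 < j \<and> j < inv \<sigma> i \<and> \<sigma> j < i \<and> i < \<sigma> (j - 1)}"

text \<open>
  If \<open>i \<in> Dasc n \<sigma> - Arda n \<sigma>\<close>, then \<open>i\<close> is followed directly by a larger value and later by a
  smaller one, so \<open>pat_2_31 n i \<sigma> \<ge> 1\<close> and the natural number \<open>pat_2_31 n i \<sigma> - 1\<close> is not truncated.
\<close>

definition pat_2_31 :: "nat \<Rightarrow> nat \<Rightarrow> (nat \<Rightarrow> nat) \<Rightarrow> nat" where
  "pat_2_31 n i \<sigma> = card {j. inv \<sigma> i < j \<and> j < n \<and> \<sigma> (j + 1) < i \<and> i < \<sigma> j}"

subsection \<open>The indeterminates\<close>

datatype indet = A nat nat | B nat nat | C nat nat | D nat nat | E nat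

text \<open>
  The polynomial ring over the integers in the indeterminates \<open>indet\<close>, represented as the
  monoid ring of the finitely supported exponent vectors.
\<close>

type_synonym int_mpoly = "(indet \<Rightarrow>\<^sub>0 nat) \<Rightarrow>\<^sub>0 int"

definition X :: "indet \<Rightarrow> int_mpoly" where
  "X v = Poly_Mapping.single (Poly_Mapping.single v 1) 1"

definition indet_a :: "nat \<Rightarrow> nat \<Rightarrow> int_mpoly" where "indet_a l l' = X (A l l')"
definition indet_b :: "nat \<Rightarrow> nat \<Rightarrow> int_mpoly" where "indet_b l l' = X (B l l')"
definition indet_c :: "nat \<Rightarrow> nat \<Rightarrow> int_mpoly" where "indet_c l l' = X (C l l')"
definition indet_d :: "nat \<Rightarrow> nat \<Rightarrow> int_mpoly" where "indet_d l l' = X (D l l')"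
definition indet_e :: "nat \<Rightarrow> int_mpoly" where "indet_e l = X (E l)"

end

(* Scanning the values from 1 to n, both families of statistics encode a permutation as a Laguerre
   history: a Motzkin path whose steps carry the indeterminate contributed by the current value.
   On the cyclic side the height before i is the number of x < i with \<sigma> x \<ge> i; on the linear side
   it is the number of descents from a letter \<ge> i to a letter < i. Both encodings are injective, and
   there are at most n! Laguerre histories of length n, because the histories ending at height h
   satisfy the recurrence of n! * (n choose h). Hence both encodings are bijections onto the same
   set, and both sums equal the weight enumerator of Laguerre histories. *)
theory Submission
  imports Defs
begin

subsection \<open>Laguerre histories\<close>

text \<open>The height fixes the sum of the two indices, so one index is free. At height
  \<open>h\<close> this gives \<open>h + 1\<close> up steps, \<open>h\<close> down steps and
  \<open>2 * h + 1\<close> level steps, the weights of the continued fraction for the generating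
  function of the factorials.\<close>

inductive step :: "nat \<Rightarrow> indet \<Rightarrow> nat \<Rightarrow> bool" where
  A: "h = l + l' \<Longrightarrow> step h (A l l') (Suc h)"
| B: "h = l + l' \<Longrightarrow> step (Suc h) (B l l') h"
| C: "h = Suc (l + l') \<Longrightarrow> step h (C l l') h"
| D: "h = Suc (l + l') \<Longrightarrow> step h (D l l') h"
| E: "step h (E h) h"

text \<open>The most recent step of a history is its first letter.\<close>

primrec histories :: "nat \<Rightarrow> nat \<Rightarrow> indet list set" where
  "histories 0 h = (if h = 0 then {[]} else {})"
| "histories (Suc n) h = {x # w | x w h'. step h' x h \<and> w \<in> histories n h'}"

section \<open>Bounding the number of histories\<close>

lemma steps_up: "{x. step h x (Suc h)} \<subseteq> (\<lambda>l. A l (h - l)) ` {..h}"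
proof
  fix x assume "x \<in> {x. step h x (Suc h)}"
  then have "step h x (Suc h)" by simp
  then show "x \<in> (\<lambda>l. A l (h - l)) ` {..h}" by cases auto
qed

lemma steps_down: "{x. step (Suc h) x h} \<subseteq> (\<lambda>l. B l (h - l)) ` {..h}"
proof
  fix x assume "x \<in> {x. step (Suc h) x h}"
  then have "step (Suc h) x h" by simp
  then show "x \<in> (\<lambda>l. B l (h - l)) ` {..h}" by cases auto
qed

lemma steps_level:
  "{x. step h x h} \<subseteq> insert (E h) ((\<lambda>l. C l (h - Suc l)) ` {..<h} \<union> (\<lambda>l. D l (h - Suc l)) ` {..<h})"
proof
  fix x assume "x \<in> {x. step h x h}"
  then have "step h x h" by simp
  then show "x \<in> insert (E h) ((\<lambda>l. C l (h - Suc l)) ` {..<h} \<union> (\<lambda>l. D l (h - Suc l)) ` {..<h})"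
    by cases auto
qed

lemma finite_steps:
  "finite {x. step h x (Suc h)}" "finite {x. step (Suc h) x h}" "finite {x. step h x h}"
  by (rule finite_subset[OF steps_up] finite_subset[OF steps_down] finite_subset[OF steps_level]; simp)+

lemma card_steps_up: "card {x. step h x (Suc h)} \<le> Suc h"
  using surj_card_le[OF _ steps_up] by simp

lemma card_steps_down: "card {x. step (Suc h) x h} \<le> Suc h"
  using surj_card_le[OF _ steps_down] by simp

lemma card_steps_level: "card {x. step h x h} \<le> 2 * h + 1"
proof -
  let ?C = "(\<lambda>l. C l (h - Suc l)) ` {..<h}" and ?D = "(\<lambda>l. D l (h - Suc l)) ` {..<h}"
  have "card {x. step h x h} \<le> card (insert (E h) (?C \<union> ?D))"
    by (rule card_mono[OF _ steps_level]) simp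
  also have "\<dots> \<le> Suc (card (?C \<union> ?D))" by (rule card_insert_le_m1) auto
  also have "card (?C \<union> ?D) \<le> card ?C + card ?D" by (rule card_Un_le)
  also have "card ?C \<le> h" by (metis card_image_le card_lessThan finite_lessThan)
  also have "card ?D \<le> h" by (metis card_image_le card_lessThan finite_lessThan)
  finally show ?thesis by simp
qed

lemma step_cases: "step h' x h \<Longrightarrow> h' = h \<or> h' = Suc h \<or> h = Suc h'"
  by (induction rule: step.induct) auto

text \<open>Pascal's rule and two instances of the absorption identity. The coefficients count the
  up steps from \<open>h\<close>, the level steps at \<open>Suc h\<close> and the down steps from
  \<open>Suc (Suc h)\<close>, so \<open>fact n * (n choose h)\<close> obeys the recurrence of
  histories over their final height.\<close>

lemma binomial_recurrence:
  "(n + 1) * (Suc n choose Suc h) =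
     (h + 1) * (n choose h) + (2 * h + 3) * (n choose Suc h) + (h + 2) * (n choose Suc (Suc h))"
proof -
  have "(h + 2) * (Suc n choose Suc (Suc h)) = (n + 1) * (n choose Suc h)"
    using Suc_times_binomial_eq[of n "Suc h"] by (simp add: mult.commute)
  moreover have "(h + 1) * (Suc n choose Suc h) = (n + 1) * (n choose h)"
    using Suc_times_binomial_eq[of n h] by (simp add: mult.commute)
  ultimately show ?thesis by (simp add: algebra_simps)
qed

text \<open>Induction on the length, splitting off the last step. All final heights are treated at
  once because that step may start at a neighbouring height; the application is at height
  \<open>0\<close>, where the bound is \<open>fact n\<close>.\<close>

lemma histories_card: "finite (histories n h) \<and> card (histories n h) \<le> fact n * (n choose h)"
proof (induction n arbitrary: h)
  case 0
  then show ?case by simp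
next
  case (Suc n)
  \<comment> \<open>One-step extensions to height \<open>h\<close>; by \<open>step_cases\<close>
    only starting heights at distance at most one from \<open>h\<close> contribute.\<close>
  let ?ext = "\<lambda>h'. (\<lambda>(x, w). x # w) ` ({x. step h' x h} \<times> histories n h')"
  have ext: "finite (?ext h')" "card (?ext h') \<le> k * (fact n * (n choose h'))"
    if "finite {x. step h' x h}" "card {x. step h' x h} \<le> k" for h' k
  proof -
    show "finite (?ext h')" using that Suc.IH by simp
    have "card (?ext h') \<le> card ({x. step h' x h} \<times> histories n h')"
      by (rule card_image_le) (use that Suc.IH in simp)
    also have "\<dots> \<le> k * (fact n * (n choose h'))"
      unfolding card_cartesian_product by (rule mult_le_mono) (use that Suc.IH in auto)
    finally show "card (?ext h') \<le> k * (fact n * (n choose h'))" .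
  qed
  note level = ext[OF finite_steps(3) card_steps_level]
  note down = ext[OF finite_steps(2) card_steps_down]
  show ?case
  proof (cases h)
    \<comment> \<open>No step comes from below height \<open>0\<close>, so here the recurrence has
      two terms and is computed directly.\<close>
    case 0
    have sub: "histories (Suc n) h \<subseteq> ?ext h \<union> ?ext (Suc h)"
      using step_cases 0 by fastforce
    have "card (histories (Suc n) h) \<le> card (?ext h \<union> ?ext (Suc h))"
      by (rule card_mono[OF _ sub]) (use level down in blast)
    also have "\<dots> \<le> card (?ext h) + card (?ext (Suc h))" by (rule card_Un_le)
    also have "\<dots> \<le> (2 * h + 1) * (fact n * (n choose h)) + Suc h * (fact n * (n choose Suc h))"
      by (rule add_mono[OF level(2) down(2)])
    also have "\<dots> = fact (Suc n) * (Suc n choose h)" using 0 by (simp add: algebra_simps)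
    finally show ?thesis using finite_subset[OF sub] level down by blast
  next
    case (Suc k)
    have up: "finite (?ext k)" "card (?ext k) \<le> Suc k * (fact n * (n choose k))"
      using ext[of k "Suc k"] finite_steps(1)[of k] card_steps_up[of k] Suc by simp_all
    have sub: "histories (Suc n) h \<subseteq> ?ext k \<union> ?ext h \<union> ?ext (Suc h)"
      using step_cases Suc by fastforce
    have "card (histories (Suc n) h) \<le> card (?ext k \<union> ?ext h \<union> ?ext (Suc h))"
      by (rule card_mono[OF _ sub]) (use level down up in blast)
    also have "\<dots> \<le> card (?ext k) + card (?ext h) + card (?ext (Suc h))"
      by (meson add_le_mono card_Un_le le_refl le_trans)
    also have "\<dots> \<le> Suc k * (fact n * (n choose k)) + (2 * h + 1) * (fact n * (n choose h))
        + Suc h * (fact n * (n choose Suc h))"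
      by (rule add_mono[OF add_mono[OF up(2) level(2)] down(2)])
    also have "\<dots> = fact n * ((k + 1) * (n choose k) + (2 * k + 3) * (n choose Suc k)
        + (k + 2) * (n choose Suc (Suc k)))" unfolding Suc by (simp add: algebra_simps)
    also have "\<dots> = fact (Suc n) * (Suc n choose h)"
      unfolding binomial_recurrence[symmetric] Suc by (simp add: algebra_simps)
    finally show ?thesis using finite_subset[OF sub] level down up by blast
  qed
qed

section \<open>From letters attached to values to histories\<close>

primrec word :: "(nat \<Rightarrow> indet) \<Rightarrow> nat \<Rightarrow> indet list" where
  "word f 0 = []"
| "word f (Suc k) = f (Suc k) # word f k"

lemma word_eq_iff: "word f k = word g k \<longleftrightarrow> (\<forall>i\<in>{1..k}. f i = g i)"
  by (induction k) (auto simp: atLeastAtMostSuc_conv)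

lemma prod_list_word: "prod_list (map X (word f k)) = (\<Prod>i\<in>{1..k}. X (f i))"
  by (induction k) (auto simp: atLeastAtMostSuc_conv)

text \<open>Here \<open>h i\<close> is the height before the value \<open>i\<close>, so
  \<open>h (Suc k)\<close> is the height reached after \<open>k\<close> values.\<close>

lemma word_in_histories:
  assumes "h 1 = 0" "\<And>i. i \<in> {1..n} \<Longrightarrow> step (h i) (f i) (h (Suc i))" "k \<le> n"
  shows "word f k \<in> histories k (h (Suc k))"
  using assms(3)
proof (induction k)
  case 0
  then show ?case using assms(1) by simp
next
  case (Suc k)
  then have "step (h (Suc k)) (f (Suc k)) (h (Suc (Suc k)))" by (intro assms(2)) auto
  then show ?case using Suc by auto
qed

text \<open>Since there are at most \<open>n!\<close> histories, an injective map into them is onto.\<close>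

lemma sum_word_eq_sum_histories:
  assumes inj: "\<And>\<sigma> \<tau>. \<sigma> permutes {1..n} \<Longrightarrow> \<tau> permutes {1..n} \<Longrightarrow>
      (\<And>i. i \<in> {1..n} \<Longrightarrow> f \<sigma> i = f \<tau> i) \<Longrightarrow> \<sigma> = \<tau>"
    and mem: "\<And>\<sigma>. \<sigma> permutes {1..n} \<Longrightarrow> word (f \<sigma>) n \<in> histories n 0"
  shows "(\<Sum>\<sigma> | \<sigma> permutes {1..n}. \<Prod>i\<in>{1..n}. X (f \<sigma> i)) =
    (\<Sum>w\<in>histories n 0. prod_list (map X w))"
proof -
  let ?S = "{\<sigma>. \<sigma> permutes {1..n}}" and ?g = "\<lambda>\<sigma>. word (f \<sigma>) n"
  have inj_on: "inj_on ?g ?S"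
    by (rule inj_onI) (auto simp: word_eq_iff intro!: inj)
  have "?g ` ?S = histories n 0"
  proof (rule card_seteq)
    show "finite (histories n 0)" using histories_card by blast
    show "?g ` ?S \<subseteq> histories n 0" using mem by auto
    show "card (histories n 0) \<le> card (?g ` ?S)"
      using histories_card[of n 0] card_permutations[of "{1..n}" n]
      unfolding card_image[OF inj_on] by simp
  qed
  then have "bij_betw ?g ?S (histories n 0)" using inj_on by (simp add: bij_betw_def)
  from sum.reindex_bij_betw[OF this, of "\<lambda>w. prod_list (map X w)"]
  show ?thesis by (simp add: prod_list_word)
qed

lemma prod_five_classes:
  fixes g :: "'a \<Rightarrow> 'b::comm_monoid_mult"
  assumes "finite S" "S = S1 \<union> S2 \<union> S3 \<union> S4 \<union> S5"
    and "S1 \<inter> S2 = {}" "(S1 \<union> S2) \<inter> S3 = {}" "(S1 \<union> S2 \<union> S3) \<inter> S4 = {}"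
      "(S1 \<union> S2 \<union> S3 \<union> S4) \<inter> S5 = {}"
  shows "prod g S = prod g S1 * prod g S2 * prod g S3 * prod g S4 * prod g S5"
  using assms by (simp add: prod.union_disjoint)

subsection \<open>The cyclic side\<close>

context linorder
begin

text \<open>At the largest excedance \<open>j\<close> where \<open>\<sigma>\<close> and \<open>\<tau>\<close> differ, both images are taken from the same
  set of still unused excedance values, so the larger image has more of these below it.\<close>

lemma card_crossings_less:
  assumes S: "finite S" "\<sigma> permutes S" "\<tau> permutes S"
    and inv: "\<And>i. i \<in> S \<Longrightarrow> inv \<sigma> i < i \<longleftrightarrow> inv \<tau> i < i"
    and above: "\<And>i. i \<in> S \<Longrightarrow> j < i \<Longrightarrow> i < \<tau> i \<Longrightarrow> \<sigma> i = \<tau> i"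
    and j: "j < \<sigma> j" "\<sigma> j < \<tau> j"
  shows "card {k. j < k \<and> k < \<sigma> j \<and> inv \<sigma> k < j} < card {k. j < k \<and> k < \<tau> j \<and> inv \<tau> k < j}"
    (is "card ?U < card ?V")
proof (rule psubset_card_mono)
  \<comment> \<open>Such a \<open>k\<close> is an excedance value of \<open>\<sigma>\<close>, hence
    of \<open>\<tau>\<close>. Were its position under \<open>\<tau>\<close> beyond \<open>j\<close>,
    both permutations would agree there, and \<open>\<sigma>\<close> would also take the value
    \<open>k\<close> beyond \<open>j\<close>. Allowing \<open>inv \<sigma> k = j\<close> covers
    \<open>k = \<sigma> j\<close>, the element that makes the inclusion strict.\<close>
  have mem: "inv \<tau> k < j" if k: "j < k" "k < \<tau> j" "inv \<sigma> k \<le> j" for k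
  proof (rule ccontr)
    assume "\<not> inv \<tau> k < j"
    have "k \<in> S" using k permutes_not_in[OF permutes_inv[OF S(2)], of k] by force
    have "inv \<tau> k < k" using inv[OF \<open>k \<in> S\<close>] k by auto
    have tk: "\<tau> (inv \<tau> k) = k" using permutes_inverses[OF S(3)] by simp
    then have "inv \<tau> k \<noteq> j" using k by auto
    with \<open>\<not> inv \<tau> k < j\<close> have "j < inv \<tau> k" by auto
    moreover have "inv \<tau> k \<in> S"
      using \<open>k \<in> S\<close> permutes_in_image[OF permutes_inv[OF S(3)]] by simp
    ultimately have "\<sigma> (inv \<tau> k) = k" using above[of "inv \<tau> k"] tk \<open>inv \<tau> k < k\<close> by simp
    then have "inv \<sigma> k = inv \<tau> k" using permutes_inverses(2)[OF S(2), of "inv \<tau> k"] by simp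
    with k \<open>j < inv \<tau> k\<close> show False by auto
  qed
  have "k \<in> S" if "k \<in> ?V" for k
    using that permutes_not_in[OF permutes_inv[OF S(3)], of k] by force
  then show "finite ?V" using finite_subset[OF _ S(1)] by blast
  have "\<sigma> j \<in> ?V" using mem[of "\<sigma> j"] j permutes_inverses(2)[OF S(2), of j] by auto
  moreover have "?U \<subseteq> ?V" using mem j by auto
  ultimately show "?U \<subset> ?V" by auto
qed

text \<open>Excedance positions and excedance values are common to both permutations. If images are
  assigned from the largest position downwards, the crossing number ranks the image among the values
  still free; hence the largest position of disagreement contradicts
  \<open>card_crossings_less\<close>.\<close>

lemma excedances_determined:
  assumes S: "finite S" "\<sigma> permutes S" "\<tau> permutes S"
    and exc: "\<And>i. i \<in> S \<Longrightarrow> i < \<sigma> i \<longleftrightarrow> i < \<tau> i"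
    and inv: "\<And>i. i \<in> S \<Longrightarrow> inv \<sigma> i < i \<longleftrightarrow> inv \<tau> i < i"
    and cross: "\<And>j. j \<in> S \<Longrightarrow> j < \<sigma> j \<Longrightarrow> card {k. j < k \<and> k < \<sigma> j \<and> inv \<sigma> k < j} =
      card {k. j < k \<and> k < \<tau> j \<and> inv \<tau> k < j}"
    and j: "j \<in> S" "j < \<sigma> j"
  shows "\<sigma> j = \<tau> j"
proof (rule ccontr)
  assume neq: "\<sigma> j \<noteq> \<tau> j"
  define bad where "bad = {i \<in> S. i < \<sigma> i \<and> \<sigma> i \<noteq> \<tau> i}"
  have fin: "finite bad" and "bad \<noteq> {}" using S(1) j neq by (auto simp: bad_def)
  define m where "m = Max bad"
  have m: "m \<in> S" "m < \<sigma> m" "\<sigma> m \<noteq> \<tau> m"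
    using Max_in[OF fin \<open>bad \<noteq> {}\<close>] by (auto simp: m_def bad_def)
  have above: "\<sigma> i = \<tau> i" if "i \<in> S" "m < i" "i < \<sigma> i" for i
  proof (rule ccontr)
    assume "\<sigma> i \<noteq> \<tau> i"
    then have "i \<le> m" unfolding m_def using that by (intro Max_ge[OF fin]) (simp add: bad_def)
    then show False using that by simp
  qed
  have "m < \<tau> m" using exc m by blast
  consider "\<sigma> m < \<tau> m" | "\<tau> m < \<sigma> m" using m by force
  then show False
  proof cases
    case 1
    have "card {k. m < k \<and> k < \<sigma> m \<and> inv \<sigma> k < m} < card {k. m < k \<and> k < \<tau> m \<and> inv \<tau> k < m}"
      by (rule card_crossings_less[OF S]) (use inv above m 1 exc in auto)
    then show False using cross[of m] m by simp
  next
    case 2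
    have "card {k. m < k \<and> k < \<tau> m \<and> inv \<tau> k < m} < card {k. m < k \<and> k < \<sigma> m \<and> inv \<sigma> k < m}"
      by (rule card_crossings_less[OF S(1,3,2)]) (use inv above m 2 \<open>m < \<tau> m\<close> in auto)
    then show False using cross[of m] m by simp
  qed
qed

end

text \<open>The reason for working in an arbitrary linear order: reversing it exchanges excedances
  with antiexcedances, and the counted sets become those of \<open>lcross_eq'\<close>.\<close>

lemmas antiexcedances_determined = linorder.excedances_determined[OF linorder_class.dual_linorder]

section \<open>The cyclic encoding\<close>

definition cyclic_letter :: "nat \<Rightarrow> (nat \<Rightarrow> nat) \<Rightarrow> nat \<Rightarrow> indet" where
  "cyclic_letter n \<sigma> i =
    (if \<sigma> i = i then E (lev n i \<sigma>)
     else if i < \<sigma> i then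
       (if i < inv \<sigma> i then A (ucross n i \<sigma>) (unest n i \<sigma>) else D (ucross n i \<sigma>) (unest n i \<sigma>))
     else
       (if i < inv \<sigma> i then C (lcross n i \<sigma>) (lnest n i \<sigma>) else B (lcross n i \<sigma>) (lnest n i \<sigma>)))"

lemma card_eq_by_projection:
  assumes "\<And>x. x \<in> S \<Longrightarrow> f x \<in> T" "\<And>y. y \<in> T \<Longrightarrow> g y \<in> S"
    and "\<And>x. x \<in> S \<Longrightarrow> g (f x) = x" "\<And>y. y \<in> T \<Longrightarrow> f (g y) = y"
  shows "card S = card T"
  by (rule bij_betw_same_card[of f], rule bij_betwI[of f S T g]) (use assms in auto)

locale perm =
  fixes n :: nat and \<sigma> :: "nat \<Rightarrow> nat"
  assumes perm: "\<sigma> permutes {1..n}"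
begin

lemma inv_apply [simp]: "inv \<sigma> (\<sigma> i) = i" and apply_inv [simp]: "\<sigma> (inv \<sigma> i) = i"
  using permutes_inverses[OF perm] by simp_all

lemma inv_eq_iff: "inv \<sigma> i = k \<longleftrightarrow> i = \<sigma> k"
  by auto

lemma eq_iff [simp]: "\<sigma> i = \<sigma> k \<longleftrightarrow> i = k"
  by (metis inv_apply)

lemma mem_iff: "\<sigma> i \<in> {1..n} \<longleftrightarrow> i \<in> {1..n}"
  by (rule permutes_in_image[OF perm])

lemma inv_mem_iff: "inv \<sigma> i \<in> {1..n} \<longleftrightarrow> i \<in> {1..n}"
  using mem_iff[of "inv \<sigma> i"] by simp

lemma apply_outside: "\<not> (1 \<le> i \<and> i \<le> n) \<Longrightarrow> \<sigma> i = i"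
  using permutes_not_in[OF perm, of i] by simp

text \<open>This discharges the range conditions in the statistics: every index occurring in a
  crossing or nesting is moved by \<open>\<sigma>\<close> or is the image of a moved index.\<close>

lemma moved: "\<sigma> i \<noteq> i \<Longrightarrow> 1 \<le> i \<and> i \<le> n \<and> 1 \<le> \<sigma> i \<and> \<sigma> i \<le> n"
  using apply_outside[of i] mem_iff[of i] by auto

lemma ucross_eq: "ucross n j \<sigma> = card {i. i < j \<and> j < \<sigma> i \<and> \<sigma> i < \<sigma> j}"
  unfolding ucross_def
  by (rule card_eq_by_projection[where f = fst and g = "\<lambda>i. (i, \<sigma> i, \<sigma> j)"])
    (use moved moved[of j] in fastforce)+

text \<open>Counting by the value \<open>\<sigma> i\<close> instead of the position \<open>i\<close>
  gives the form taken by \<open>excedances_determined\<close>.\<close>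

lemma ucross_eq': "ucross n j \<sigma> = card {k. j < k \<and> k < \<sigma> j \<and> inv \<sigma> k < j}"
  unfolding ucross_eq by (rule card_eq_by_projection[where f = \<sigma> and g = "inv \<sigma>"]) auto

lemma unest_eq: "j < \<sigma> j \<Longrightarrow> unest n j \<sigma> = card {i. i < j \<and> \<sigma> j < \<sigma> i}"
  unfolding unest_def
  by (rule card_eq_by_projection[where f = fst and g = "\<lambda>i. (i, \<sigma> j, \<sigma> i)"])
    (use moved moved[of j] in fastforce)+

lemma lcross_eq: "lcross n k \<sigma> = card {l. k < l \<and> \<sigma> l < k \<and> \<sigma> k < \<sigma> l}"
  unfolding lcross_def
  by (rule card_eq_by_projection[where f = "\<lambda>(i, j, l). l" and g = "\<lambda>l. (\<sigma> k, \<sigma> l, l)"])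
    (use moved moved[of k] in fastforce)+

lemma lcross_eq': "lcross n k \<sigma> = card {j. j < k \<and> \<sigma> k < j \<and> k < inv \<sigma> j}"
  unfolding lcross_eq by (rule card_eq_by_projection[where f = \<sigma> and g = "inv \<sigma>"]) auto

lemma lnest_eq: "\<sigma> k < k \<Longrightarrow> lnest n k \<sigma> = card {l. k < l \<and> \<sigma> l < \<sigma> k}"
  unfolding lnest_def
  by (rule card_eq_by_projection[where f = "\<lambda>(i, j, l). l" and g = "\<lambda>l. (\<sigma> l, \<sigma> k, l)"])
    (use moved moved[of k] in fastforce)+

lemma lev_eq: "lev n j \<sigma> = card {i. i < j \<and> j < \<sigma> i}"
  unfolding lev_def
  by (rule card_eq_by_projection[where f = fst and g = "\<lambda>i. (i, \<sigma> i)"])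
    (use moved in fastforce)+

definition exceeding :: "nat \<Rightarrow> nat set" where
  "exceeding i = {x. x < i \<and> i \<le> \<sigma> x}"

lemma bij_betw_below: "bij_betw \<sigma> {x. \<sigma> x < i} {..<i}"
  by (rule bij_betwI[where g = "inv \<sigma>"]) auto

lemma finite_below: "finite {x. \<sigma> x < i}"
  using bij_betw_finite[OF bij_betw_below] by simp

text \<open>There are \<open>i\<close> positions below \<open>i\<close> and \<open>i\<close>
  positions with a value below \<open>i\<close>; the common part cancels. The right-hand side
  expresses the height through antiexcedances, as suits \<open>lcross\<close> and
  \<open>lnest\<close>.\<close>

lemma card_exceeding_eq: "card (exceeding i) = card {x. i \<le> x \<and> \<sigma> x < i}"
proof -
  let ?low = "{x. x < i \<and> \<sigma> x < i}" and ?below = "{x. i \<le> x \<and> \<sigma> x < i}"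
  have "card ?low + card (exceeding i) = card (?low \<union> exceeding i)"
    by (rule card_Un_disjoint[symmetric]) (auto simp: exceeding_def)
  also have "?low \<union> exceeding i = {..<i}" by (auto simp: exceeding_def)
  also have "card \<dots> = card {x. \<sigma> x < i}"
    using bij_betw_same_card[OF bij_betw_below] by (rule sym)
  also have "{x. \<sigma> x < i} = ?low \<union> ?below" by auto
  also have "card (?low \<union> ?below) = card ?low + card ?below"
    by (rule card_Un_disjoint) (auto intro: finite_subset[OF _ finite_below[of i]])
  finally show ?thesis by simp
qed

text \<open>\<open>lev\<close> serves as a reference for every \<open>i\<close>, fixed or not. The
  height before \<open>i\<close> may add the excedance arriving at \<open>i\<close>, and the height
  after \<open>i\<close> the excedance leaving \<open>i\<close>, see
  \<open>card_exceeding_Suc\<close>.\<close>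

lemma card_exceeding:
  "card (exceeding i) = lev n i \<sigma> + (if inv \<sigma> i < i then 1 else 0)"
proof -
  have "exceeding i = {x. x < i \<and> i < \<sigma> x} \<union> (if inv \<sigma> i < i then {inv \<sigma> i} else {})"
    by (auto simp: exceeding_def order.order_iff_strict)
  then show ?thesis by (subst lev_eq) (auto simp: card_insert_if)
qed

lemma card_exceeding_Suc:
  "card (exceeding (Suc i)) = lev n i \<sigma> + (if i < \<sigma> i then 1 else 0)"
proof -
  have "exceeding (Suc i) = {x. x < i \<and> i < \<sigma> x} \<union> (if i < \<sigma> i then {i} else {})"
    by (auto simp: exceeding_def less_Suc_eq)
  then show ?thesis by (subst lev_eq) (auto simp: card_insert_if)
qed

text \<open>An arc passing over \<open>i\<close> ends either before \<open>\<sigma> i\<close>, which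
  is a crossing, or after it, which is a nesting.\<close>

lemma ucross_plus_unest:
  assumes "i < \<sigma> i"
  shows "ucross n i \<sigma> + unest n i \<sigma> = lev n i \<sigma>"
proof -
  let ?c = "{x. x < i \<and> i < \<sigma> x \<and> \<sigma> x < \<sigma> i}" and ?n = "{x. x < i \<and> \<sigma> i < \<sigma> x}"
  have "{x. x < i \<and> i < \<sigma> x} = ?c \<union> ?n"
    using assms by (auto simp: not_less order.order_iff_strict)
  then have "lev n i \<sigma> = card (?c \<union> ?n)" by (simp only: lev_eq)
  also have "\<dots> = card ?c + card ?n" by (rule card_Un_disjoint) auto
  finally show ?thesis unfolding ucross_eq unest_eq[OF assms] by (rule sym)
qed

text \<open>The height is counted through \<open>card_exceeding_eq\<close>; the \<open>Suc\<close>
  is the position \<open>i\<close> itself, which lies in that set because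
  \<open>\<sigma> i < i\<close>.\<close>

lemma lcross_plus_lnest:
  assumes "\<sigma> i < i"
  shows "Suc (lcross n i \<sigma> + lnest n i \<sigma>) = card (exceeding i)"
proof -
  let ?c = "{l. i < l \<and> \<sigma> l < i \<and> \<sigma> i < \<sigma> l}" and ?n = "{l. i < l \<and> \<sigma> l < \<sigma> i}"
  have fin: "finite ?c" "finite ?n"
    using assms by (auto intro: finite_subset[OF _ finite_below[of i]])
  have "{x. i \<le> x \<and> \<sigma> x < i} = insert i (?c \<union> ?n)"
    using assms by (auto simp: not_less order.order_iff_strict)
  then have "card (exceeding i) = card (insert i (?c \<union> ?n))" by (simp only: card_exceeding_eq)
  also have "\<dots> = Suc (card (?c \<union> ?n))" using fin by (intro card_insert_disjoint) auto
  also have "card (?c \<union> ?n) = card ?c + card ?n" using fin by (intro card_Un_disjoint) auto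
  finally show ?thesis unfolding lcross_eq lnest_eq[OF assms] by (rule sym)
qed

lemma cycle_type_cases:
  obtains "\<sigma> i = i" "inv \<sigma> i = i" | "i < \<sigma> i" "i < inv \<sigma> i" | "i < \<sigma> i" "inv \<sigma> i < i"
    | "\<sigma> i < i" "i < inv \<sigma> i" | "\<sigma> i < i" "inv \<sigma> i < i"
  using inv_eq_iff[of i i] by (metis linorder_neqE_nat)

lemma cyclic_step: "step (card (exceeding i)) (cyclic_letter n \<sigma> i) (card (exceeding (Suc i)))"
  by (cases rule: cycle_type_cases[of i])
    (use ucross_plus_unest[of i] lcross_plus_lnest[of i] in
      \<open>simp_all add: cyclic_letter_def card_exceeding[of i] card_exceeding_Suc step.intros\<close>)

lemma cyclic_word_in_histories: "word (cyclic_letter n \<sigma>) n \<in> histories n 0"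
proof -
  have "\<not> n < \<sigma> i" if "i < Suc n" for i
    using moved[of i] that by (cases "\<sigma> i = i") auto
  then have "exceeding (Suc n) = {}" by (auto simp: exceeding_def Suc_le_eq)
  moreover have "exceeding 1 = {}" using apply_outside[of 0] by (auto simp: exceeding_def)
  ultimately show ?thesis
    using word_in_histories[of "\<lambda>i. card (exceeding i)" n "cyclic_letter n \<sigma>" n] cyclic_step by simp
qed

lemma cyclic_prod:
  "(\<Prod>i\<in>Cval n \<sigma>. indet_a (ucross n i \<sigma>) (unest n i \<sigma>)) *
   (\<Prod>i\<in>Cpeak n \<sigma>. indet_b (lcross n i \<sigma>) (lnest n i \<sigma>)) *
   (\<Prod>i\<in>Cdfall n \<sigma>. indet_c (lcross n i \<sigma>) (lnest n i \<sigma>)) *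
   (\<Prod>i\<in>Cdrise n \<sigma>. indet_d (ucross n i \<sigma>) (unest n i \<sigma>)) *
   (\<Prod>i\<in>Fix n \<sigma>. indet_e (lev n i \<sigma>)) = (\<Prod>i\<in>{1..n}. X (cyclic_letter n \<sigma> i))"
proof -
  have eq: "{1..n} = Cval n \<sigma> \<union> Cpeak n \<sigma> \<union> Cdfall n \<sigma> \<union> Cdrise n \<sigma> \<union> Fix n \<sigma>"
  proof (rule set_eqI)
    fix i
    show "i \<in> {1..n} \<longleftrightarrow> i \<in> Cval n \<sigma> \<union> Cpeak n \<sigma> \<union> Cdfall n \<sigma> \<union> Cdrise n \<sigma> \<union> Fix n \<sigma>"
      by (cases rule: cycle_type_cases[of i])
        (auto simp: Cval_def Cpeak_def Cdfall_def Cdrise_def Fix_def)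
  qed
  have "(\<Prod>i\<in>{1..n}. X (cyclic_letter n \<sigma> i)) =
      (\<Prod>i\<in>Cval n \<sigma>. X (cyclic_letter n \<sigma> i)) * (\<Prod>i\<in>Cpeak n \<sigma>. X (cyclic_letter n \<sigma> i)) *
      (\<Prod>i\<in>Cdfall n \<sigma>. X (cyclic_letter n \<sigma> i)) * (\<Prod>i\<in>Cdrise n \<sigma>. X (cyclic_letter n \<sigma> i)) *
      (\<Prod>i\<in>Fix n \<sigma>. X (cyclic_letter n \<sigma> i))"
    by (rule prod_five_classes[OF _ eq]) (auto simp: Cval_def Cpeak_def Cdfall_def Cdrise_def Fix_def)
  moreover have "(\<Prod>i\<in>Cval n \<sigma>. X (cyclic_letter n \<sigma> i)) =
      (\<Prod>i\<in>Cval n \<sigma>. indet_a (ucross n i \<sigma>) (unest n i \<sigma>))"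
    by (rule prod.cong) (auto simp: Cval_def cyclic_letter_def indet_a_def)
  moreover have "(\<Prod>i\<in>Cpeak n \<sigma>. X (cyclic_letter n \<sigma> i)) =
      (\<Prod>i\<in>Cpeak n \<sigma>. indet_b (lcross n i \<sigma>) (lnest n i \<sigma>))"
    by (rule prod.cong) (auto simp: Cpeak_def cyclic_letter_def indet_b_def)
  moreover have "(\<Prod>i\<in>Cdfall n \<sigma>. X (cyclic_letter n \<sigma> i)) =
      (\<Prod>i\<in>Cdfall n \<sigma>. indet_c (lcross n i \<sigma>) (lnest n i \<sigma>))"
    by (rule prod.cong) (auto simp: Cdfall_def cyclic_letter_def indet_c_def)
  moreover have "(\<Prod>i\<in>Cdrise n \<sigma>. X (cyclic_letter n \<sigma> i)) =
      (\<Prod>i\<in>Cdrise n \<sigma>. indet_d (ucross n i \<sigma>) (unest n i \<sigma>))"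
    by (rule prod.cong) (auto simp: Cdrise_def cyclic_letter_def indet_d_def)
  moreover have "(\<Prod>i\<in>Fix n \<sigma>. X (cyclic_letter n \<sigma> i)) = (\<Prod>i\<in>Fix n \<sigma>. indet_e (lev n i \<sigma>))"
    by (rule prod.cong) (auto simp: Fix_def cyclic_letter_def indet_e_def)
  ultimately show ?thesis by simp
qed

end

text \<open>The constructor shows how \<open>i\<close> compares with \<open>\<sigma> i\<close> and
  \<open>inv \<sigma> i\<close>; except for \<open>E\<close>, the first index is a crossing number.
  Excedances and antiexcedances are recovered separately, and only fixed points remain.\<close>

lemma cyclic_letter_determines:
  assumes "\<sigma> permutes {1..n}" "\<tau> permutes {1..n}"
    and eq: "\<And>i. i \<in> {1..n} \<Longrightarrow> cyclic_letter n \<sigma> i = cyclic_letter n \<tau> i"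
  shows "\<sigma> = \<tau>"
proof
  interpret s: perm n \<sigma> by unfold_locales fact
  interpret t: perm n \<tau> by unfold_locales fact
  \<comment> \<open>\<open>inv_eq_iff\<close> turns \<open>\<sigma> i \<noteq> i\<close> into
    \<open>inv \<sigma> i \<noteq> i\<close>, so a failed test \<open>i < inv \<sigma> i\<close>
    means \<open>inv \<sigma> i < i\<close>.\<close>
  have type: "i < \<sigma> i \<longleftrightarrow> i < \<tau> i" "\<sigma> i < i \<longleftrightarrow> \<tau> i < i"
    "inv \<sigma> i < i \<longleftrightarrow> inv \<tau> i < i" "i < inv \<sigma> i \<longleftrightarrow> i < inv \<tau> i" if "i \<in> {1..n}" for i
    using eq[OF that] s.inv_eq_iff[of i i] t.inv_eq_iff[of i i]
    unfolding cyclic_letter_def by (auto split: if_splits)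
  have upper: "ucross n i \<sigma> = ucross n i \<tau>" if "i \<in> {1..n}" "i < \<sigma> i" for i
    using eq[OF that(1)] type(1)[OF that(1)] that(2) unfolding cyclic_letter_def
    by (auto split: if_splits)
  have lower: "lcross n i \<sigma> = lcross n i \<tau>" if "i \<in> {1..n}" "\<sigma> i < i" for i
    using eq[OF that(1)] type(2)[OF that(1)] that(2) unfolding cyclic_letter_def
    by (auto split: if_splits)
  fix i
  consider "i \<notin> {1..n}" | "i \<in> {1..n}" "i < \<sigma> i" | "i \<in> {1..n}" "\<sigma> i < i"
    | "i \<in> {1..n}" "\<sigma> i = i" by force
  then show "\<sigma> i = \<tau> i"
  proof cases
    case 1
    then show ?thesis using s.apply_outside t.apply_outside by simp
  next
    case 2
    show ?thesis
      by (rule excedances_determined[OF _ assms(1,2) type(1,3) _ 2])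
        (use upper in \<open>simp_all add: s.ucross_eq' t.ucross_eq'\<close>)
  next
    case 3
    show ?thesis
      by (rule antiexcedances_determined[OF _ assms(1,2) type(2,4) _ 3])
        (use lower in \<open>simp_all add: s.lcross_eq' t.lcross_eq'\<close>)
  next
    case 4
    then show ?thesis using type(1,2)[of i] by force
  qed
qed

subsection \<open>The linear side\<close>

text \<open>Among double ascents, the test \<open>pat_2_31 n i \<sigma> = 0\<close> singles out the
  antirecords, see \<open>antirecord_iff\<close>.\<close>

definition linear_letter :: "nat \<Rightarrow> (nat \<Rightarrow> nat) \<Rightarrow> nat \<Rightarrow> indet" where
  "linear_letter n \<sigma> i =
    (if i < \<sigma> (inv \<sigma> i - 1) then
       (if \<sigma> (inv \<sigma> i + 1) < i then D (pat_2_31 n i \<sigma>) (pat_31_2 i \<sigma>)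
        else A (pat_2_31 n i \<sigma>) (pat_31_2 i \<sigma>))
     else if \<sigma> (inv \<sigma> i + 1) < i then B (pat_2_31 n i \<sigma>) (pat_31_2 i \<sigma>)
     else if pat_2_31 n i \<sigma> = 0 then E (pat_31_2 i \<sigma>)
     else C (pat_2_31 n i \<sigma> - 1) (pat_31_2 i \<sigma>))"

context perm
begin

text \<open>The descents passing strictly over \<open>i\<close>, indexed by the position of the
  upper letter. They form the common part of \<open>drops i\<close> and
  \<open>drops (Suc i)\<close>, whose sizes are the heights before and after
  \<open>i\<close>.\<close>

definition crossings :: "nat \<Rightarrow> nat set" where
  "crossings i = {j. \<sigma> (Suc j) < i \<and> i < \<sigma> j}"

definition drops :: "nat \<Rightarrow> nat set" where
  "drops i = {j. \<sigma> (Suc j) < i \<and> i \<le> \<sigma> j}"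

lemma finite_drops: "finite (drops i)"
proof (rule finite_subset)
  show "drops i \<subseteq> {..n}"
  proof
    fix j assume j: "j \<in> drops i"
    show "j \<in> {..n}"
    proof (rule ccontr)
      assume "j \<notin> {..n}"
      then have "\<sigma> j = j" "\<sigma> (Suc j) = Suc j" using apply_outside by auto
      with j show False by (auto simp: drops_def)
    qed
  qed
qed simp

lemma crossings_subset_drops: "crossings i \<subseteq> drops i"
  by (auto simp: crossings_def drops_def)

lemma finite_crossings: "finite (crossings i)"
  using finite_subset[OF crossings_subset_drops finite_drops] .

lemma inv_pos: "i \<in> {1..n} \<Longrightarrow> inv \<sigma> i \<noteq> 0"
  using inv_mem_iff[of i] by auto

lemma inv_cancel: "inv \<sigma> i = inv \<sigma> k \<longleftrightarrow> i = k"
  by (metis apply_inv)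

text \<open>The height before \<open>i\<close> may additionally count the descent out of
  \<open>i\<close>, and the height after \<open>i\<close> the descent into \<open>i\<close>, see
  \<open>drops_Suc_eq\<close>.\<close>

lemma drops_eq: "drops i = crossings i \<union> (if \<sigma> (Suc (inv \<sigma> i)) < i then {inv \<sigma> i} else {})"
  by (auto simp: drops_def crossings_def order.order_iff_strict)

lemma drops_Suc_eq:
  assumes "i \<in> {1..n}"
  shows "drops (Suc i) = crossings i \<union> (if i < \<sigma> (inv \<sigma> i - 1) then {inv \<sigma> i - 1} else {})"
proof -
  have "\<sigma> (Suc j) = i \<longleftrightarrow> j = inv \<sigma> i - 1" for j
    using inv_pos[OF assms] inv_eq_iff[of i "Suc j"] by auto
  then show ?thesis by (auto simp: drops_def crossings_def less_Suc_eq Suc_le_eq)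
qed

lemma inv_notin_crossings: "inv \<sigma> i \<notin> crossings i"
  by (simp add: crossings_def)

lemma pred_notin_crossings: "i \<in> {1..n} \<Longrightarrow> inv \<sigma> i - 1 \<notin> crossings i"
  using inv_pos[of i] by (simp add: crossings_def)

text \<open>The definition indexes a descent by its lower letter, \<open>crossings\<close> by its
  upper one; hence the shift by one.\<close>

lemma pat_31_2_eq:
  assumes "i \<in> {1..n}"
  shows "pat_31_2 i \<sigma> = card {j \<in> crossings i. j < inv \<sigma> i}"
  unfolding pat_31_2_def
proof (rule card_eq_by_projection[where f = "\<lambda>j. j - 1" and g = Suc])
  fix j assume j: "j \<in> {j \<in> crossings i. j < inv \<sigma> i}"
  \<comment> \<open>The letter \<open>\<sigma> 0 = 0\<close> cannot exceed \<open>i\<close>. This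
    yields the bound \<open>1 < Suc j\<close>.\<close>
  have "j \<noteq> 0" using j apply_outside[of 0] by (auto simp: crossings_def intro!: Nat.gr0I)
  moreover have "Suc j \<noteq> inv \<sigma> i" using j by (auto simp: crossings_def)
  ultimately show "Suc j \<in> {j. 1 < j \<and> j < inv \<sigma> i \<and> \<sigma> j < i \<and> i < \<sigma> (j - 1)}"
    using j by (auto simp: crossings_def)
qed (auto simp: crossings_def)

lemma pat_2_31_eq:
  assumes "i \<in> {1..n}"
  shows "pat_2_31 n i \<sigma> = card {j \<in> crossings i. inv \<sigma> i < j}"
proof -
  have "j < n" if "\<sigma> (Suc j) < i" for j
  proof (rule ccontr)
    assume "\<not> j < n"
    then have "\<sigma> (Suc j) = Suc j" using apply_outside by simp
    with that assms \<open>\<not> j < n\<close> show False by simp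
  qed
  then show ?thesis unfolding pat_2_31_def crossings_def
    by (intro arg_cong[of _ _ card]) auto
qed

lemma pat_sum:
  assumes "i \<in> {1..n}"
  shows "pat_2_31 n i \<sigma> + pat_31_2 i \<sigma> = card (crossings i)"
proof -
  let ?r = "{j \<in> crossings i. inv \<sigma> i < j}" and ?l = "{j \<in> crossings i. j < inv \<sigma> i}"
  have "?r \<union> ?l = {j \<in> crossings i. j \<noteq> inv \<sigma> i}" by auto
  also have "\<dots> = crossings i" using inv_notin_crossings by auto
  finally have "card (crossings i) = card (?r \<union> ?l)" by simp
  also have "\<dots> = card ?r + card ?l"
    by (rule card_Un_disjoint) (auto simp: finite_crossings)
  finally show ?thesis using pat_31_2_eq[OF assms] pat_2_31_eq[OF assms] by simp
qed

lemma card_drops: "card (drops i) = card (crossings i) + (if \<sigma> (Suc (inv \<sigma> i)) < i then 1 else 0)"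
  unfolding drops_eq using finite_crossings inv_notin_crossings by auto

lemma card_drops_Suc:
  assumes "i \<in> {1..n}"
  shows "card (drops (Suc i)) = card (crossings i) + (if i < \<sigma> (inv \<sigma> i - 1) then 1 else 0)"
  unfolding drops_Suc_eq[OF assms] using finite_crossings pred_notin_crossings[OF assms] by auto

text \<open>The two indices add up to the number of crossings. A descent out of \<open>i\<close>
  raises the height before it by one, a descent into \<open>i\<close> the height after it. For
  \<open>C\<close> the \<open>Suc\<close> in \<open>step\<close> restores the subtracted one; for
  \<open>E\<close> the vanishing \<open>pat_2_31\<close> leaves \<open>pat_31_2\<close> as the
  height.\<close>

lemma linear_step:
  assumes "i \<in> {1..n}"
  shows "step (card (drops i)) (linear_letter n \<sigma> i) (card (drops (Suc i)))"
  by (simp add: linear_letter_def card_drops[of i] card_drops_Suc[OF assms] pat_sum[OF assms, symmetric]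
      step.intros)

lemma linear_word_in_histories: "word (linear_letter n \<sigma>) n \<in> histories n 0"
proof -
  have "\<sigma> (Suc j) \<noteq> 0" for j using eq_iff[of "Suc j" 0] apply_outside[of 0] by simp
  then have "drops 1 = {}" by (simp add: drops_def)
  moreover have "drops (Suc n) = {}"
  proof -
    have "False" if "j \<in> drops (Suc n)" for j
    proof -
      have j: "\<sigma> (Suc j) \<le> n" "n < \<sigma> j" using that by (auto simp: drops_def)
      then have "\<sigma> j = j" using moved[of j] by force
      then have "\<sigma> (Suc j) = Suc j" using j apply_outside[of "Suc j"] by simp
      then show False using j \<open>\<sigma> j = j\<close> by simp
    qed
    then show ?thesis by blast
  qed
  ultimately show ?thesis
    using word_in_histories[of "\<lambda>i. card (drops i)" n "linear_letter n \<sigma>" n] linear_step by simp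
qed

section \<open>The relative order of the letters\<close>

text \<open>Cut the word \<open>\<sigma>\<close> into maximal blocks of letters less than \<open>i\<close>; this is the index of the block
  of \<open>u\<close>, where the block \<open>0\<close> contains the initial \<open>0\<close>.\<close>

definition block :: "nat \<Rightarrow> nat \<Rightarrow> nat" where
  "block i u = card {j \<in> drops i. j < inv \<sigma> u}"

text \<open>Exactly \<open>pat_31_2 i \<sigma>\<close> drops lie to the left of \<open>i\<close>, so
  \<open>i\<close> stands to the right of the blocks with index up to this number and to the left of
  all others.\<close>

lemma left_iff_block_le:
  assumes i: "i \<in> {1..n}" and u: "u < i"
  shows "inv \<sigma> u < inv \<sigma> i \<longleftrightarrow> block i u \<le> pat_31_2 i \<sigma>"
proof (cases "inv \<sigma> u < inv \<sigma> i")
  case True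
  then have "{j \<in> drops i. j < inv \<sigma> u} \<subseteq> {j \<in> crossings i. j < inv \<sigma> i}"
    by (auto simp: drops_eq split: if_splits)
  then show ?thesis unfolding block_def pat_31_2_eq[OF i]
    using True finite_crossings by (auto intro: card_mono)
next
  case False
  then have right: "inv \<sigma> i < inv \<sigma> u" using u inv_cancel[of i u] by auto
  \<comment> \<open>The first position right of \<open>i\<close> with a letter below
    \<open>i\<close>. The letter just before it is at least \<open>i\<close>, possibly
    \<open>i\<close> itself, so a drop lies between \<open>i\<close> and \<open>u\<close> and pushes
    the block index beyond \<open>pat_31_2 i \<sigma>\<close>.\<close>
  define k where "k = (LEAST k. inv \<sigma> i < k \<and> \<sigma> k < i)"
  have k: "inv \<sigma> i < k \<and> \<sigma> k < i"
    unfolding k_def by (rule LeastI[of _ "inv \<sigma> u"]) (use right u in simp)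
  have "k \<le> inv \<sigma> u" unfolding k_def by (rule Least_le) (use right u in simp)
  obtain j where j: "k = Suc j" using k by (cases k) auto
  have "\<not> (inv \<sigma> i < j \<and> \<sigma> j < i)"
    using not_less_Least[of j "\<lambda>k. inv \<sigma> i < k \<and> \<sigma> k < i", folded k_def] j by simp
  then have "i \<le> \<sigma> j" using k j by (auto simp: less_Suc_eq)
  with k j have "j \<in> drops i" by (simp add: drops_def)
  then have "insert j {j \<in> crossings i. j < inv \<sigma> i} \<subseteq> {j \<in> drops i. j < inv \<sigma> u}"
    using crossings_subset_drops right \<open>k \<le> inv \<sigma> u\<close> j by auto
  then have "card (insert j {j \<in> crossings i. j < inv \<sigma> i}) \<le> block i u"
    unfolding block_def by (rule card_mono[rotated]) (simp add: finite_drops)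
  moreover have "\<not> j < inv \<sigma> i" using k j by simp
  ultimately show ?thesis unfolding pat_31_2_eq[OF i]
    using False finite_crossings by auto
qed

text \<open>Among the letters up to \<open>i\<close>, the letter \<open>i\<close> opens a new block
  if its left neighbour is larger, and otherwise joins the block of that neighbour.\<close>

lemma block_Suc_self:
  assumes i: "i \<in> {1..n}"
  shows "block (Suc i) i = pat_31_2 i \<sigma> + (if i < \<sigma> (inv \<sigma> i - 1) then 1 else 0)"
proof -
  have "{j \<in> drops (Suc i). j < inv \<sigma> i} =
      {j \<in> crossings i. j < inv \<sigma> i} \<union> (if i < \<sigma> (inv \<sigma> i - 1) then {inv \<sigma> i - 1} else {})"
    using inv_pos[OF i] by (auto simp: drops_Suc_eq[OF i])
  then show ?thesis unfolding block_def pat_31_2_eq[OF i]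
    using finite_crossings pred_notin_crossings[OF i] by auto
qed

text \<open>Admitting \<open>i\<close> to the blocks removes the descent out of \<open>i\<close> and
  adds the descent into \<open>i\<close>; both affect only letters to the right of \<open>i\<close>.
  Terms stand on both sides to avoid subtraction of natural numbers.\<close>

lemma block_Suc:
  assumes i: "i \<in> {1..n}" and u: "u < i"
  shows "block (Suc i) u + (if inv \<sigma> i < inv \<sigma> u \<and> \<sigma> (Suc (inv \<sigma> i)) < i then 1 else 0) =
    block i u + (if inv \<sigma> i < inv \<sigma> u \<and> i < \<sigma> (inv \<sigma> i - 1) then 1 else 0)"
proof -
  let ?c = "{j \<in> crossings i. j < inv \<sigma> u}"
  have neq: "inv \<sigma> i \<noteq> inv \<sigma> u" using u inv_cancel[of i u] by auto
  have "{j \<in> drops i. j < inv \<sigma> u} =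
      ?c \<union> (if inv \<sigma> i < inv \<sigma> u \<and> \<sigma> (Suc (inv \<sigma> i)) < i then {inv \<sigma> i} else {})"
    by (auto simp: drops_eq)
  then have "block i u = card ?c + (if inv \<sigma> i < inv \<sigma> u \<and> \<sigma> (Suc (inv \<sigma> i)) < i then 1 else 0)"
    unfolding block_def using finite_crossings inv_notin_crossings by auto
  moreover have "inv \<sigma> i - 1 < inv \<sigma> u \<longleftrightarrow> inv \<sigma> i < inv \<sigma> u" using neq inv_pos[OF i] by auto
  then have "{j \<in> drops (Suc i). j < inv \<sigma> u} =
      ?c \<union> (if inv \<sigma> i < inv \<sigma> u \<and> i < \<sigma> (inv \<sigma> i - 1) then {inv \<sigma> i - 1} else {})"
    by (auto simp: drops_Suc_eq[OF i])
  then have "block (Suc i) u = card ?c + (if inv \<sigma> i < inv \<sigma> u \<and> i < \<sigma> (inv \<sigma> i - 1) then 1 else 0)"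
    unfolding block_def using finite_crossings pred_notin_crossings[OF i] by auto
  ultimately show ?thesis by simp
qed

text \<open>This makes a permutation recoverable from the relative order of the positions of its
  letters.\<close>

lemma inv_eq_card: "u \<in> {1..n} \<Longrightarrow> inv \<sigma> u = Suc (card {v \<in> {1..n}. inv \<sigma> v < inv \<sigma> u})"
proof -
  assume u: "u \<in> {1..n}"
  then have pos: "1 \<le> inv \<sigma> u \<and> inv \<sigma> u \<le> n" using inv_mem_iff[of u] by auto
  have "card {v \<in> {1..n}. inv \<sigma> v < inv \<sigma> u} = card {1..<inv \<sigma> u}"
    by (rule card_eq_by_projection[where f = "inv \<sigma>" and g = \<sigma>])
      (use pos inv_mem_iff mem_iff in fastforce)+
  then show ?thesis using pos by simp
qed

section \<open>The classes of values and their weights\<close>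

lemma pred_cases:
  assumes "i \<in> {1..n}"
  obtains "i < \<sigma> (inv \<sigma> i - 1)" | "\<sigma> (inv \<sigma> i - 1) < i"
  using inv_pos[OF assms] inv_eq_iff[of i "inv \<sigma> i - 1"]
  by (metis diff_less less_irrefl linorder_neqE_nat neq0_conv zero_less_one)

lemma succ_cases:
  obtains "i < \<sigma> (inv \<sigma> i + 1)" | "\<sigma> (inv \<sigma> i + 1) < i"
  using inv_eq_iff[of i "inv \<sigma> i + 1"] by (metis n_not_Suc_n Suc_eq_plus1 linorder_neqE_nat)

lemma mem_values_iff: "i \<in> {\<sigma> k | k. k \<in> {1..n} \<and> P k (\<sigma> k)} \<longleftrightarrow> i \<in> {1..n} \<and> P (inv \<sigma> i) i"
proof
  assume "i \<in> {1..n} \<and> P (inv \<sigma> i) i"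
  then show "i \<in> {\<sigma> k | k. k \<in> {1..n} \<and> P k (\<sigma> k)}"
    using inv_mem_iff[of i] by (intro CollectI exI[of _ "inv \<sigma> i"]) simp
next
  assume "i \<in> {\<sigma> k | k. k \<in> {1..n} \<and> P k (\<sigma> k)}"
  then obtain k where "i = \<sigma> k" "k \<in> {1..n}" "P k (\<sigma> k)" by blast
  then show "i \<in> {1..n} \<and> P (inv \<sigma> i) i" using mem_iff[of k] by simp
qed

lemma linear_sets:
  "Dasc n \<sigma> = {i \<in> {1..n}. \<sigma> (inv \<sigma> i - 1) < i \<and> i < \<sigma> (inv \<sigma> i + 1)}"
  "Ddes n \<sigma> = {i \<in> {1..n}. i < \<sigma> (inv \<sigma> i - 1) \<and> \<sigma> (inv \<sigma> i + 1) < i}"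
  "Peak n \<sigma> = {i \<in> {1..n}. \<sigma> (inv \<sigma> i - 1) < i \<and> \<sigma> (inv \<sigma> i + 1) < i}"
  "Val n \<sigma> = {i \<in> {1..n}. i < \<sigma> (inv \<sigma> i - 1) \<and> i < \<sigma> (inv \<sigma> i + 1)}"
  unfolding Dasc_def Ddes_def Peak_def Val_def by (rule set_eqI, subst mem_values_iff, simp)+

lemma Antirecord_eq: "Antirecord n \<sigma> = {i \<in> {1..n}. \<forall>j. inv \<sigma> i < j \<and> j \<le> n \<longrightarrow> i < \<sigma> j}"
  unfolding Antirecord_def by (rule set_eqI, subst mem_values_iff, simp)

text \<open>A double ascent is followed by a larger letter, so a smaller letter further right is
  reached only through a descent over \<open>i\<close>, which \<open>pat_2_31\<close>
  counts.\<close>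

lemma antirecord_iff:
  assumes "i \<in> Dasc n \<sigma>"
  shows "i \<in> Antirecord n \<sigma> \<longleftrightarrow> pat_2_31 n i \<sigma> = 0"
proof -
  have i: "i \<in> {1..n}" and succ: "i < \<sigma> (Suc (inv \<sigma> i))" using assms by (auto simp: linear_sets)
  have zero: "pat_2_31 n i \<sigma> = 0 \<longleftrightarrow> {j \<in> crossings i. inv \<sigma> i < j} = {}"
    unfolding pat_2_31_eq[OF i] using finite_crossings by simp
  show ?thesis
  proof
    assume "i \<in> Antirecord n \<sigma>"
    then have *: "i < \<sigma> j" if "inv \<sigma> i < j" for j
      using that i apply_outside[of j] by (cases "j \<le> n") (auto simp: Antirecord_eq)
    have "\<not> \<sigma> (Suc j) < i" if "inv \<sigma> i < j" for j
      using *[of "Suc j"] that by simp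
    then show "pat_2_31 n i \<sigma> = 0" unfolding zero by (auto simp: crossings_def)
  next
    assume 0: "pat_2_31 n i \<sigma> = 0"
    have "i < \<sigma> j" if "Suc (inv \<sigma> i) \<le> j" for j
      using that
    proof (induction j rule: dec_induct)
      case base
      show ?case by (rule succ)
    next
      case (step j)
      then have "\<not> \<sigma> (Suc j) < i" using 0 zero by (auto simp: crossings_def)
      moreover have "\<sigma> (Suc j) \<noteq> i" using step.hyps inv_eq_iff[of i "Suc j"] by auto
      ultimately show ?case by simp
    qed
    then show "i \<in> Antirecord n \<sigma>" using i by (auto simp: Antirecord_eq)
  qed
qed

lemma linear_prod:
  "(\<Prod>i\<in>Val n \<sigma>. indet_a (pat_2_31 n i \<sigma>) (pat_31_2 i \<sigma>)) *
   (\<Prod>i\<in>Peak n \<sigma>. indet_b (pat_2_31 n i \<sigma>) (pat_31_2 i \<sigma>)) *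
   (\<Prod>i\<in>Dasc n \<sigma> - Arda n \<sigma>. indet_c (pat_2_31 n i \<sigma> - 1) (pat_31_2 i \<sigma>)) *
   (\<Prod>i\<in>Ddes n \<sigma>. indet_d (pat_2_31 n i \<sigma>) (pat_31_2 i \<sigma>)) *
   (\<Prod>i\<in>Arda n \<sigma>. indet_e (pat_31_2 i \<sigma>)) = (\<Prod>i\<in>{1..n}. X (linear_letter n \<sigma> i))"
proof -
  have Arda: "Arda n \<sigma> = {i \<in> Dasc n \<sigma>. pat_2_31 n i \<sigma> = 0}"
    using antirecord_iff by (auto simp: Arda_def)
  have eq: "{1..n} = Val n \<sigma> \<union> Peak n \<sigma> \<union> (Dasc n \<sigma> - Arda n \<sigma>) \<union> Ddes n \<sigma> \<union> Arda n \<sigma>"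
  proof (rule set_eqI)
    fix i
    show "i \<in> {1..n} \<longleftrightarrow>
      i \<in> Val n \<sigma> \<union> Peak n \<sigma> \<union> (Dasc n \<sigma> - Arda n \<sigma>) \<union> Ddes n \<sigma> \<union> Arda n \<sigma>"
    proof (cases "i \<in> {1..n}")
      case True
      then show ?thesis
        by (cases rule: pred_cases; cases rule: succ_cases[of i]) (auto simp: linear_sets Arda)
    qed (auto simp: linear_sets Arda)
  qed
  have "(\<Prod>i\<in>{1..n}. X (linear_letter n \<sigma> i)) =
      (\<Prod>i\<in>Val n \<sigma>. X (linear_letter n \<sigma> i)) * (\<Prod>i\<in>Peak n \<sigma>. X (linear_letter n \<sigma> i)) *
      (\<Prod>i\<in>Dasc n \<sigma> - Arda n \<sigma>. X (linear_letter n \<sigma> i)) *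
      (\<Prod>i\<in>Ddes n \<sigma>. X (linear_letter n \<sigma> i)) * (\<Prod>i\<in>Arda n \<sigma>. X (linear_letter n \<sigma> i))"
    by (rule prod_five_classes[OF _ eq]) (auto simp: linear_sets Arda)
  moreover have "(\<Prod>i\<in>Val n \<sigma>. X (linear_letter n \<sigma> i)) =
      (\<Prod>i\<in>Val n \<sigma>. indet_a (pat_2_31 n i \<sigma>) (pat_31_2 i \<sigma>))"
    by (rule prod.cong) (auto simp: linear_sets linear_letter_def indet_a_def)
  moreover have "(\<Prod>i\<in>Peak n \<sigma>. X (linear_letter n \<sigma> i)) =
      (\<Prod>i\<in>Peak n \<sigma>. indet_b (pat_2_31 n i \<sigma>) (pat_31_2 i \<sigma>))"
    by (rule prod.cong) (auto simp: linear_sets linear_letter_def indet_b_def)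
  moreover have "(\<Prod>i\<in>Dasc n \<sigma> - Arda n \<sigma>. X (linear_letter n \<sigma> i)) =
      (\<Prod>i\<in>Dasc n \<sigma> - Arda n \<sigma>. indet_c (pat_2_31 n i \<sigma> - 1) (pat_31_2 i \<sigma>))"
    by (rule prod.cong) (auto simp: linear_sets Arda linear_letter_def indet_c_def)
  moreover have "(\<Prod>i\<in>Ddes n \<sigma>. X (linear_letter n \<sigma> i)) =
      (\<Prod>i\<in>Ddes n \<sigma>. indet_d (pat_2_31 n i \<sigma>) (pat_31_2 i \<sigma>))"
    by (rule prod.cong) (auto simp: linear_sets linear_letter_def indet_d_def)
  moreover have "(\<Prod>i\<in>Arda n \<sigma>. X (linear_letter n \<sigma> i)) = (\<Prod>i\<in>Arda n \<sigma>. indet_e (pat_31_2 i \<sigma>))"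
    by (rule prod.cong) (auto simp: linear_sets Arda linear_letter_def indet_e_def)
  ultimately show ?thesis by simp
qed

end

text \<open>Values are inserted in increasing order: once the blocks of smaller letters are known,
  \<open>pat_31_2\<close> tells between which blocks \<open>i\<close> stands. This yields the
  relative order of all positions, hence the permutation.\<close>

lemma linear_letter_determines:
  assumes "\<sigma> permutes {1..n}" "\<tau> permutes {1..n}"
    and eq: "\<And>i. i \<in> {1..n} \<Longrightarrow> linear_letter n \<sigma> i = linear_letter n \<tau> i"
  shows "\<sigma> = \<tau>"
proof -
  interpret s: perm n \<sigma> by unfold_locales fact
  interpret t: perm n \<tau> by unfold_locales fact
  \<comment> \<open>The constructor gives the comparisons with both neighbours, and
    \<open>pat_31_2\<close> is the last index of every letter.\<close>
  have type: "i < \<sigma> (inv \<sigma> i - 1) \<longleftrightarrow> i < \<tau> (inv \<tau> i - 1)"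
    "\<sigma> (Suc (inv \<sigma> i)) < i \<longleftrightarrow> \<tau> (Suc (inv \<tau> i)) < i"
    "pat_31_2 i \<sigma> = pat_31_2 i \<tau>" if "i \<in> {1..n}" for i
    using eq[OF that] unfolding linear_letter_def by (auto split: if_splits)
  \<comment> \<open>Equal indices of the letters below \<open>i\<close> give equal comparisons with
    \<open>i\<close> by \<open>left_iff_block_le\<close>; then \<open>block_Suc_self\<close> and
    \<open>block_Suc\<close> give equal indices at the next stage.\<close>
  have block: "s.block i u = t.block i u" if "u \<in> {1..<i}" "i \<le> Suc n" for i u
    using that
  proof (induction i arbitrary: u)
    case (Suc i)
    then have i: "i \<in> {1..n}" by auto
    show ?case
    proof (cases "u = i")
      case True
      then show ?thesis using s.block_Suc_self[OF i] t.block_Suc_self[OF i] type[OF i] by simp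
    next
      case False
      then have u: "u < i" "u \<in> {1..<i}" using Suc.prems by auto
      have IH: "s.block i u = t.block i u" using Suc.IH u i by simp
      then have "inv \<sigma> u < inv \<sigma> i \<longleftrightarrow> inv \<tau> u < inv \<tau> i"
        using s.left_iff_block_le[OF i u(1)] t.left_iff_block_le[OF i u(1)] type[OF i] by simp
      moreover have "inv \<sigma> u \<noteq> inv \<sigma> i" "inv \<tau> u \<noteq> inv \<tau> i"
        using u s.inv_cancel t.inv_cancel by simp_all
      ultimately have "inv \<sigma> i < inv \<sigma> u \<longleftrightarrow> inv \<tau> i < inv \<tau> u" by auto
      then show ?thesis
        using s.block_Suc[OF i u(1)] t.block_Suc[OF i u(1)] IH type[OF i] by (simp split: if_splits)
    qed
  qed simp
  have left: "inv \<sigma> u < inv \<sigma> i \<longleftrightarrow> inv \<tau> u < inv \<tau> i" if "u \<in> {1..n}" "i \<in> {1..n}" "u < i" for u i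
    using s.left_iff_block_le[OF that(2,3)] t.left_iff_block_le[OF that(2,3)] type[OF that(2)]
      block[of u i] that by simp
  have order: "inv \<sigma> u < inv \<sigma> v \<longleftrightarrow> inv \<tau> u < inv \<tau> v" if "u \<in> {1..n}" "v \<in> {1..n}" for u v
    using left[OF that] left[OF that(2,1)] s.inv_cancel[of u v] t.inv_cancel[of u v]
    by (cases u v rule: linorder_cases) auto
  have "inv \<sigma> u = inv \<tau> u" for u
  proof (cases "u \<in> {1..n}")
    case True
    then have "{v \<in> {1..n}. inv \<sigma> v < inv \<sigma> u} = {v \<in> {1..n}. inv \<tau> v < inv \<tau> u}"
      using order by blast
    then show ?thesis using s.inv_eq_card[OF True] t.inv_eq_card[OF True] by simp
  next
    case False
    then have "\<sigma> u = u" "\<tau> u = u" using s.apply_outside[of u] t.apply_outside[of u] by auto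
    then show ?thesis by (metis s.inv_apply t.inv_apply)
  qed
  then have "inv \<sigma> = inv \<tau>" by blast
  then show ?thesis
    using permutes_inv_inv[OF assms(1)] permutes_inv_inv[OF assms(2)] by metis
qed

theorem theorem3p2:
  fixes n :: nat
  shows "Q n indet_a indet_b indet_c indet_d indet_e =
    (\<Sum>\<sigma> | \<sigma> permutes {1..n}.
       (\<Prod>i\<in>Val n \<sigma>. indet_a (pat_2_31 n i \<sigma>) (pat_31_2 i \<sigma>)) *
       (\<Prod>i\<in>Peak n \<sigma>. indet_b (pat_2_31 n i \<sigma>) (pat_31_2 i \<sigma>)) *
       (\<Prod>i\<in>Dasc n \<sigma> - Arda n \<sigma>. indet_c (pat_2_31 n i \<sigma> - 1) (pat_31_2 i \<sigma>)) *
       (\<Prod>i\<in>Ddes n \<sigma>. indet_d (pat_2_31 n i \<sigma>) (pat_31_2 i \<sigma>)) *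
       (\<Prod>i\<in>Arda n \<sigma>. indet_e (pat_31_2 i \<sigma>)))"
proof -
  let ?S = "{\<sigma>. \<sigma> permutes {1..n}}"
  have "Q n indet_a indet_b indet_c indet_d indet_e =
      (\<Sum>\<sigma>\<in>?S. \<Prod>i\<in>{1..n}. X (cyclic_letter n \<sigma> i))"
    unfolding Q_def by (intro sum.cong refl perm.cyclic_prod perm.intro) simp
  also have "\<dots> = (\<Sum>w\<in>histories n 0. prod_list (map X w))"
    by (rule sum_word_eq_sum_histories[OF cyclic_letter_determines
          perm.cyclic_word_in_histories[OF perm.intro]])
  also have "\<dots> = (\<Sum>\<sigma>\<in>?S. \<Prod>i\<in>{1..n}. X (linear_letter n \<sigma> i))"
    by (rule sum_word_eq_sum_histories[OF linear_letter_determines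
          perm.linear_word_in_histories[OF perm.intro], symmetric])
  finally show ?thesis
    by (rule trans) (intro sum.cong refl perm.linear_prod[symmetric] perm.intro; simp)
qed

end
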